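(* Let $f$ be a smooth function near $(0,0)$ with $f=x^2-a^2y^2+b_0x^3+b_1x^2y+b_2xy^2+b_3y^3+\text{h.o.t.}$, $a>0$, and let $VH_1,VH_2,VH_3,VH_4$ be the four smooth branches of the vertex set $V_f=0$ through the origin, tangent respectively to $x=0$, $y=0$, $x=ay$, $x=-ay$. The limiting curvature, as $k\to0$, of the level curves $f=k$ at the vertices on these branches (that is, the limit, as a point $q\ne(0,0)$ of the branch tends to the origin, of the curvature at $q$ of the level curve of $f$ through $q$) is, up to sign: - infinite along $VH_1$ and $VH_2$; - $\dfrac{f^{(3)}(a)}{a(1+a^2)^{3/2}}$ along $VH_3$; - $-\dfrac{f^{(3)}(-a)}{a(1+a^2)^{3/2}}$ along $VH_4$.
   Context: $f^{(3)}(s)=b_0s^3+b_1s^2+b_2s+b_3$. The vertex set, i.e. the locus of vertices (critical points of curvature) of the level curves $f=k$, is the zero set of $$\begin{aligned}V_f=&(f_x^2+f_y^2)(-f_y^3f_{xxx}+3f_xf_y^2f_{xxy}-3f_x^2f_yf_{xyy}+f_x^3f_{yyy})\\&+3f_xf_y\big(f_y^2f_{xx}^2+(f_x^2-f_y^2)f_{xx}f_{yy}-f_x^2f_{yy}^2\big)+6f_xf_yf_{xy}^2(f_x^2-f_y^2)\\&+3f_{xy}\big(f_{xx}f_y^4-3f_x^2f_y^2(f_{xx}-f_{yy})-f_{yy}f_x^4\big).\end{aligned}$$ The curvature $\kappa$ of a level curve of $f$ at a point with nonzero gradient satisfies $\kappa^2=(f_{xx}f_y^2-2f_{xy}f_xf_y+f_{yy}f_x^2)^2/(f_x^2+f_y^2)^3$.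 *)

theory Defs
  imports "HOL-Analysis.Analysis" "HOL-Library.Landau_Symbols"
begin

definition Dx :: "(real \<times> real \<Rightarrow> real) \<Rightarrow> real \<times> real \<Rightarrow> real" where
  "Dx f p = deriv (\<lambda>t. f (t, snd p)) (fst p)"

definition Dy :: "(real \<times> real \<Rightarrow> real) \<Rightarrow> real \<times> real \<Rightarrow> real" where
  "Dy f p = deriv (\<lambda>t. f (fst p, t)) (snd p)"

text \<open>Both smoothness notions below are meant for open domains.\<close>

primrec C_k_on :: "nat \<Rightarrow> (real \<times> real) set \<Rightarrow> (real \<times> real \<Rightarrow> real) \<Rightarrow> bool" where
  "C_k_on 0 U f \<longleftrightarrow> continuous_on U f"
| "C_k_on (Suc k) U f \<longleftrightarrow> f differentiable_on U \<and> C_k_on k U (Dx f) \<and> C_k_on k U (Dy f)"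

definition smooth_function_on :: "(real \<times> real) set \<Rightarrow> (real \<times> real \<Rightarrow> real) \<Rightarrow> bool" where
  "smooth_function_on U f \<longleftrightarrow> (\<forall>k. C_k_on k U f)"

definition smooth_curve_on :: "real set \<Rightarrow> (real \<Rightarrow> real \<times> real) \<Rightarrow> bool" where
  "smooth_curve_on I \<gamma> \<longleftrightarrow>
     (\<forall>k. ((\<lambda>h t. vector_derivative h (at t)) ^^ k) \<gamma> differentiable_on I)"

definition vertex_function :: "(real \<times> real \<Rightarrow> real) \<Rightarrow> real \<times> real \<Rightarrow> real" where
  "vertex_function f p =
    (let fx = Dx f p; fy = Dy f p;
         fxx = Dx (Dx f) p; fxy = Dy (Dx f) p; fyy = Dy (Dy f) p;
         fxxx = Dx (Dx (Dx f)) p; fxxy = Dy (Dx (Dx f)) p;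
         fxyy = Dy (Dy (Dx f)) p; fyyy = Dy (Dy (Dy f)) p
     in (fx^2 + fy^2) *
          (- (fy^3 * fxxx) + 3 * fx * fy^2 * fxxy - 3 * fx^2 * fy * fxyy + fx^3 * fyyy)
        + 3 * fx * fy * (fy^2 * fxx^2 + (fx^2 - fy^2) * fxx * fyy - fx^2 * fyy^2)
        + 6 * fx * fy * fxy^2 * (fx^2 - fy^2)
        + 3 * fxy * (fxx * fy^4 - 3 * fx^2 * fy^2 * (fxx - fyy) - fyy * fx^4))"

definition vertex_set :: "(real \<times> real) set \<Rightarrow> (real \<times> real \<Rightarrow> real) \<Rightarrow> (real \<times> real) set" where
  "vertex_set U f = {p \<in> U. vertex_function f p = 0}"

text \<open>
  The curvature at \<open>p\<close> of the level curve of \<open>f\<close> through \<open>p\<close>, for a nonzero gradient at \<open>p\<close>.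
  Its sign depends on an orientation of the level curve, so only its absolute value
  is used below.
\<close>

definition level_curvature :: "(real \<times> real \<Rightarrow> real) \<Rightarrow> real \<times> real \<Rightarrow> real" where
  "level_curvature f p =
    (let fx = Dx f p; fy = Dy f p;
         fxx = Dx (Dx f) p; fxy = Dy (Dx f) p; fyy = Dy (Dy f) p
     in (fxx * fy^2 - 2 * fxy * fx * fy + fyy * fx^2) / sqrt (fx^2 + fy^2) ^ 3)"

text \<open>
  \<open>B\<close> is an embedded smooth regular arc through the origin, contained in \<open>Z\<close>, with tangent
  line \<open>L\<close> at the origin. Asking for a homeomorphism onto \<open>B\<close> (and not just
  an injective parametrisation) prevents the ends of the arc from accumulating at the origin.
\<close>

definition smooth_branch ::
  "(real \<times> real) set \<Rightarrow> (real \<times> real) set \<Rightarrow> (real \<times> real) set \<Rightarrow> bool" where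
  "smooth_branch Z L B \<longleftrightarrow> B \<subseteq> Z \<and>
     (\<exists>e \<gamma> \<tau>. e > 0 \<and> smooth_curve_on {-e<..<e} \<gamma> \<and>
        homeomorphism {-e<..<e} B \<gamma> \<tau> \<and>
        (\<forall>t\<in>{-e<..<e}. vector_derivative \<gamma> (at t) \<noteq> 0) \<and>
        \<gamma> 0 = (0, 0) \<and> span {vector_derivative \<gamma> (at 0)} = L)"

text \<open>
  The filter \<open>F\<close> is \<open>nhds l\<close> for a finite limit and \<open>at_top\<close> for an infinite one. The first
  conjunct says that the curvature is defined at the points of \<open>B\<close> near the origin.
\<close>

definition limiting_abs_curvature ::
  "(real \<times> real \<Rightarrow> real) \<Rightarrow> (real \<times> real) set \<Rightarrow> real filter \<Rightarrow> bool" where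
  "limiting_abs_curvature f B F \<longleftrightarrow>
     (\<forall>\<^sub>F q in at (0, 0) within B. (Dx f q, Dy f q) \<noteq> (0, 0)) \<and>
     filterlim (\<lambda>q. \<bar>level_curvature f q\<bar>) F (at (0, 0) within B)"

end

theory Submission
  imports Defs
begin

text \<open>
  Write \<open>J\<close> for the rotation \<open>(x, y) \<mapsto> (- y, x)\<close> and \<open>w = J \<nabla>f\<close> for the tangent field of the
  level curves. The numerator of the level curvature is \<open>N = D\<^sup>2f(w, w)\<close>. Differentiating it along
  \<open>w\<close> gives \<open>T = D\<^sup>3f(w, w, w)\<close> alone, because \<open>D\<^sub>w w = J H w\<close>, with \<open>H\<close> the Hessian matrix, and
  \<open>D\<^sup>2f(J H w, w) = \<langle>J H w, H w\<rangle> = 0\<close>. With \<open>g = |\<nabla>f|\<close> and \<open>S\<close> half of the derivative of \<open>g\<^sup>2\<close>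
  along \<open>w\<close>, the derivative of \<open>N / g\<^sup>3\<close> along \<open>w\<close> is thus \<open>(g\<^sup>2 T - 3 N S) / g\<^sup>5\<close>, and the vertex
  function is exactly its numerator (\<open>vertex_function_eq\<close>). At a vertex where \<open>S \<noteq> 0\<close>, the curvature
  \<open>N / g\<^sup>3\<close> therefore equals \<open>T / (3 S g)\<close> (\<open>level_curvature_at_vertex\<close>).

  Along a branch with tangent vector \<open>v\<close> at the origin, a point \<open>q\<close> with parameter \<open>t\<close> satisfies
  \<open>q / t \<rightarrow> v\<close>, so each of these quantities, divided by the right power of \<open>t\<close>, converges to its value
  on the leading terms: \<open>\<nabla>f / t\<close> tends to \<open>(2 v\<^sub>1, - 2 a\<^sup>2 v\<^sub>2)\<close>, which is nonzero, and \<open>N / t\<^sup>2\<close> tends to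
  \<open>8 a\<^sup>2 (a\<^sup>2 v\<^sub>2\<^sup>2 - v\<^sub>1\<^sup>2)\<close>. On the branches tangent to the axes this last limit is nonzero while \<open>g\<^sup>3\<close> has
  order \<open>|t|\<^sup>3\<close>, hence the curvature tends to infinity. On the branches tangent to \<open>x = \<plusminus> a y\<close> the leading
  term of \<open>N\<close> vanishes, and its next term involves the second-order contact of the branch with its
  tangent line. The quotient \<open>T / (3 S g)\<close> is determined to leading order by \<open>v\<close> and the third-order
  Taylor polynomial of \<open>f\<close>: both \<open>T / t\<^sup>3\<close> and \<open>S g / |t|\<^sup>3\<close> converge, the second one to a nonzero limit, and
  a third of the quotient of the limits is, up to sign, the asserted value.

  The partial derivatives of \<open>f\<close> at the origin up to order three have to be read off from
  \<open>f = P + O(|p|\<^sup>4)\<close> alone. By the mean value theorem, an iterated finite difference with step \<open>h\<close>,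
  divided by \<open>h\<^sup>n\<close>, converges to the corresponding partial derivative of order \<open>n\<close>. For \<open>n \<le> 3\<close> the
  remainder contributes \<open>O(h\<^sup>4) / h\<^sup>n \<rightarrow> 0\<close>, so the derivative is the one of the polynomial \<open>P\<close>
  (\<open>iterated_partial_eq_difference_limit\<close>).
\<close>

section \<open>Partial derivatives as limits of finite differences\<close>

datatype axis = X_axis | Y_axis

primrec axis_vector :: "axis \<Rightarrow> real \<times> real" where
  "axis_vector X_axis = (1, 0)"
| "axis_vector Y_axis = (0, 1)"

primrec axis_partial :: "axis \<Rightarrow> (real \<times> real \<Rightarrow> real) \<Rightarrow> real \<times> real \<Rightarrow> real" where
  "axis_partial X_axis = Dx"
| "axis_partial Y_axis = Dy"

primrec iterated_partial ::
  "axis list \<Rightarrow> (real \<times> real \<Rightarrow> real) \<Rightarrow> real \<times> real \<Rightarrow> real" where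
  "iterated_partial [] g = g"
| "iterated_partial (d # w) g = iterated_partial w (axis_partial d g)"

primrec iterated_difference ::
  "axis list \<Rightarrow> real \<Rightarrow> (real \<times> real \<Rightarrow> real) \<Rightarrow> real \<times> real \<Rightarrow> real" where
  "iterated_difference [] h g p = g p"
| "iterated_difference (d # w) h g p =
     iterated_difference w h g (p + h *\<^sub>R axis_vector d) - iterated_difference w h g p"

text \<open>
  All nodes of a difference of order \<open>n\<close> with step \<open>h\<close> based at \<open>p\<close>, and the intermediate points of
  the mean value theorem, lie in the square of side \<open>n h\<close> with lower left corner \<open>p\<close>.
\<close>

definition grid_square :: "real \<times> real \<Rightarrow> real \<Rightarrow> (real \<times> real) set" where
  "grid_square p l = {fst p..fst p + l} \<times> {snd p..snd p + l}"

lemma has_derivative_partials: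
  assumes "(g has_derivative L) (at q)"
  shows "L (u, v) = u * Dx g q + v * Dy g q"
proof -
  interpret bounded_linear L using assms by (rule has_derivative_bounded_linear)
  have axis: "(\<lambda>t. L (t, 0)) = (\<lambda>t. L (1, 0) * t)" "(\<lambda>t. L (0, t)) = (\<lambda>t. L (0, 1) * t)"
  proof -
    have "L (t, 0) = L (1, 0) * t" "L (0, t) = L (0, 1) * t" for t
      using scaleR[of t "(1, 0)"] scaleR[of t "(0, 1)"] by (simp_all only: scaleR_Pair
          real_scaleR_def mult_1_right mult_zero_right mult.commute[of t "L _"])
    then show "(\<lambda>t. L (t, 0)) = (\<lambda>t. L (1, 0) * t)" "(\<lambda>t. L (0, t)) = (\<lambda>t. L (0, 1) * t)"
      by blast+
  qed
  have "((\<lambda>t. g (t, snd q)) has_derivative (\<lambda>t. L (t, 0))) (at (fst q))"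
    by (rule has_derivative_compose[where g = g]) (auto intro!: derivative_eq_intros assms)
  then have x: "Dx g q = L (1, 0)"
    unfolding Dx_def axis(1) has_field_derivative_def[symmetric] by (rule DERIV_imp_deriv)
  have "((\<lambda>t. g (fst q, t)) has_derivative (\<lambda>t. L (0, t))) (at (snd q))"
    by (rule has_derivative_compose[where g = g]) (auto intro!: derivative_eq_intros assms)
  then have y: "Dy g q = L (0, 1)"
    unfolding Dy_def axis(2) has_field_derivative_def[symmetric] by (rule DERIV_imp_deriv)
  have "L (u, v) = L (u *\<^sub>R (1, 0) + v *\<^sub>R (0, 1))" by simp
  then show ?thesis by (simp only: add scaleR x y real_scaleR_def)
qed

lemma axis_partial_has_derivative:
  assumes "g differentiable (at (p + s *\<^sub>R axis_vector d))"
  shows "((\<lambda>s. g (p + s *\<^sub>R axis_vector d)) has_real_derivative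
           axis_partial d g (p + s *\<^sub>R axis_vector d)) (at s)"
proof -
  obtain L where L: "(g has_derivative L) (at (p + s *\<^sub>R axis_vector d))"
    using assms by (auto simp: differentiable_def)
  have "((\<lambda>s. g (p + s *\<^sub>R axis_vector d)) has_derivative (\<lambda>t. L (t *\<^sub>R axis_vector d))) (at s)"
    by (rule has_derivative_compose[where g = g]) (auto intro!: derivative_eq_intros L)
  moreover have "L (t *\<^sub>R axis_vector d) = axis_partial d g (p + s *\<^sub>R axis_vector d) * t" for t
    by (cases d) (simp_all add: has_derivative_partials[OF L] mult.commute)
  ultimately show ?thesis by (simp add: has_field_derivative_def)
qed

lemma grid_square_step:
  assumes "0 \<le> s" "s \<le> h" "0 \<le> l"
  shows "grid_square (p + s *\<^sub>R axis_vector d) l \<subseteq> grid_square p (h + l)"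
  using assms by (cases d) (auto simp: grid_square_def)

text \<open>Partial derivatives commute with translations, hence with finite differences.\<close>

lemma iterated_difference_has_derivative:
  assumes "open U" "g differentiable_on U" "h > 0"
    and "grid_square (p + s *\<^sub>R axis_vector d) (real (length w) * h) \<subseteq> U"
  shows "((\<lambda>s. iterated_difference w h g (p + s *\<^sub>R axis_vector d)) has_real_derivative
           iterated_difference w h (axis_partial d g) (p + s *\<^sub>R axis_vector d)) (at s)"
  using assms(4)
proof (induction w arbitrary: p)
  case Nil
  moreover have "p + s *\<^sub>R axis_vector d \<in> grid_square (p + s *\<^sub>R axis_vector d) 0"
    by (simp add: grid_square_def mem_Times_iff del: fst_add snd_add fst_scaleR snd_scaleR)
  ultimately have "p + s *\<^sub>R axis_vector d \<in> U" by auto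
  then have "g differentiable (at (p + s *\<^sub>R axis_vector d))"
    using assms by (simp add: differentiable_on_eq_differentiable_at)
  then show ?case using axis_partial_has_derivative by simp
next
  case (Cons c w)
  let ?p' = "p + h *\<^sub>R axis_vector c"
  have swap: "p + r *\<^sub>R axis_vector d + h *\<^sub>R axis_vector c = ?p' + r *\<^sub>R axis_vector d" for r
    by (simp add: algebra_simps)
  have step: "grid_square (p + s *\<^sub>R axis_vector d + r *\<^sub>R axis_vector c) (real (length w) * h) \<subseteq> U"
    if "0 \<le> r" "r \<le> h" for r
    using grid_square_step[OF that, of "real (length w) * h" "p + s *\<^sub>R axis_vector d" c]
      Cons.prems \<open>h > 0\<close> by (auto simp: algebra_simps)
  have "grid_square (?p' + s *\<^sub>R axis_vector d) (real (length w) * h) \<subseteq> U"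
    using step[of h] \<open>h > 0\<close> by (simp add: swap)
  moreover have "grid_square (p + s *\<^sub>R axis_vector d) (real (length w) * h) \<subseteq> U"
    using step[of 0] \<open>h > 0\<close> by simp
  ultimately show ?case
    unfolding iterated_difference.simps swap by (intro DERIV_diff Cons.IH)
qed

text \<open>
  The outermost difference of \<open>d # w\<close> is an increment, along the axis \<open>d\<close>, of the function
  \<open>iterated_difference w h g\<close>. The classical mean value theorem turns it into \<open>h\<close> times the same
  iterated difference of \<open>axis_partial d g\<close>, to which the induction hypothesis applies.
\<close>

lemma iterated_difference_mean_value:
  assumes "open U" "h > 0"
  shows "C_k_on (length w) U g \<Longrightarrow> grid_square p (real (length w) * h) \<subseteq> U \<Longrightarrow>
    \<exists>\<xi>\<in>grid_square p (real (length w) * h).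
      iterated_difference w h g p = h ^ length w * iterated_partial w g \<xi>"
proof (induction w arbitrary: g p)
  case Nil
  then show ?case by (auto simp: grid_square_def mem_Times_iff)
next
  case (Cons d w)
  let ?l = "real (length w) * h"
  have sub: "grid_square (p + s *\<^sub>R axis_vector d) ?l \<subseteq> grid_square p (real (length (d # w)) * h)"
    if "0 \<le> s" "s \<le> h" for s
    using grid_square_step[OF that, of ?l p d] \<open>h > 0\<close> by (simp add: algebra_simps)
  have diff: "g differentiable_on U" and C: "C_k_on (length w) U (axis_partial d g)"
    using Cons.prems(1) by (cases d; simp)+
  have "\<exists>s>0. s < h \<and> iterated_difference w h g (p + h *\<^sub>R axis_vector d) -
      iterated_difference w h g (p + 0 *\<^sub>R axis_vector d) =
      (h - 0) * iterated_difference w h (axis_partial d g) (p + s *\<^sub>R axis_vector d)"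
    by (rule MVT2[OF \<open>h > 0\<close>])
      (use sub Cons.prems in \<open>blast intro: iterated_difference_has_derivative[OF assms(1) diff assms(2)]\<close>)
  then obtain s where s: "0 < s" "s < h" "iterated_difference (d # w) h g p =
      h * iterated_difference w h (axis_partial d g) (p + s *\<^sub>R axis_vector d)"
    by auto
  obtain \<xi> where "\<xi> \<in> grid_square (p + s *\<^sub>R axis_vector d) ?l"
    "iterated_difference w h (axis_partial d g) (p + s *\<^sub>R axis_vector d) =
       h ^ length w * iterated_partial w (axis_partial d g) \<xi>"
    using Cons.IH[OF C, of "p + s *\<^sub>R axis_vector d"] sub[of s] s Cons.prems(2)
    by (meson less_imp_le order_trans)
  with s sub[of s] show ?case by (intro bexI[of _ \<xi>]) auto
qed

lemma C_k_on_iterated_partial: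
  "C_k_on (length w + k) U g \<Longrightarrow> C_k_on k U (iterated_partial w g)"
proof (induction w arbitrary: g)
  case (Cons d w)
  then have "C_k_on (length w + k) U (axis_partial d g)" by (cases d) auto
  then show ?case using Cons.IH by simp
qed simp

lemma iterated_difference_quotient_tendsto:
  assumes "open U" "0 \<in> U" "C_k_on (length w) U g"
  shows "((\<lambda>h. iterated_difference w h g 0 / h ^ length w) \<longlongrightarrow> iterated_partial w g 0)
           (at_right 0)"
proof -
  let ?n = "length w"
  have "continuous_on U (iterated_partial w g)"
    using C_k_on_iterated_partial[of w 0] assms(3) by simp
  then have cont: "isCont (iterated_partial w g) 0"
    using assms by (simp add: continuous_on_eq_continuous_at)
  obtain r where r: "r > 0" "ball 0 r \<subseteq> U"
    using assms openE by blast
  show ?thesis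
  proof (rule tendstoI)
    fix e :: real assume "e > 0"
    with cont obtain \<delta> where \<delta>: "\<delta> > 0"
      "\<And>x. dist x 0 < \<delta> \<Longrightarrow> dist (iterated_partial w g x) (iterated_partial w g 0) < e"
      unfolding continuous_at_eps_delta by blast
    \<comment> \<open>Steps below \<open>\<rho>\<close> keep the whole square inside \<open>U\<close> and within \<open>\<delta>\<close> of the origin.\<close>
    define \<rho> where "\<rho> = min r \<delta> / (2 * (real ?n + 1))"
    have \<rho>: "\<rho> > 0" using r \<delta> by (simp add: \<rho>_def)
    have "dist (iterated_difference w h g 0 / h ^ ?n) (iterated_partial w g 0) < e"
      if h: "0 < h" "h < \<rho>" for h
    proof -
      have small: "norm x < min r \<delta>" if "x \<in> grid_square 0 (real ?n * h)" for x
      proof -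
        have "norm x \<le> norm (fst x) + norm (snd x)"
          by (metis norm_Pair_le prod.collapse)
        also have "\<dots> \<le> 2 * (real ?n * h)"
          using that by (auto simp: grid_square_def mem_Times_iff)
        also have "\<dots> < 2 * (real ?n + 1) * h" using h by (simp add: algebra_simps)
        also have "\<dots> < 2 * (real ?n + 1) * \<rho>" using h by simp
        also have "\<dots> = min r \<delta>" by (simp add: \<rho>_def)
        finally show ?thesis .
      qed
      then have "grid_square 0 (real ?n * h) \<subseteq> U" using r by fastforce
      then obtain \<xi> where \<xi>: "\<xi> \<in> grid_square 0 (real ?n * h)"
        "iterated_difference w h g 0 = h ^ ?n * iterated_partial w g \<xi>"
        using iterated_difference_mean_value[OF assms(1) h(1) assms(3)] by blast
      with small[of \<xi>] \<delta>(2)[of \<xi>] h show ?thesis by simp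
    qed
    then show "\<forall>\<^sub>F h in at_right 0.
        dist (iterated_difference w h g 0 / h ^ ?n) (iterated_partial w g 0) < e"
      using eventually_at_right_less \<rho> unfolding eventually_at_right_field by blast
  qed
qed

text \<open>
  The base point \<open>h *\<^sub>R z\<close> moves with the step, so that the class of nodes is closed under the recursion:
  the shifted node of a difference along \<open>d\<close> is \<open>h *\<^sub>R (z + axis_vector d)\<close>.
\<close>

lemma iterated_difference_small:
  assumes "R \<in> O[nhds 0](\<lambda>p. norm p ^ 4)" "n \<le> 3"
  shows "((\<lambda>h. iterated_difference w h R (h *\<^sub>R z) / h ^ n) \<longlongrightarrow> 0) (at_right 0)"
proof (induction w arbitrary: z)
  case Nil
  have "filterlim (\<lambda>h. h *\<^sub>R z) (nhds 0) (at_right 0)"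
    by (auto intro!: tendsto_eq_intros)
  then have "(\<lambda>h. R (h *\<^sub>R z)) \<in> O[at_right 0](\<lambda>h. norm (h *\<^sub>R z) ^ 4)"
    using assms(1) by (rule landau_o.big.compose[rotated])
  also have "(\<lambda>h. norm (h *\<^sub>R z) ^ 4) \<in> O[at_right 0](\<lambda>h::real. h ^ 4)"
    by (intro bigoI[of _ "norm z ^ 4"]) (simp add: power_mult_distrib)
  finally have 1: "(\<lambda>h. R (h *\<^sub>R z)) \<in> O[at_right 0](\<lambda>h. h ^ 4)" .
  have "(\<lambda>h::real. h ^ 4) \<in> o[at_right 0](\<lambda>h. h ^ n)"
  proof (rule smalloI_tendsto)
    have "((\<lambda>h::real. h ^ (4 - n)) \<longlongrightarrow> 0) (at_right 0)"
      using assms(2) by (auto intro!: tendsto_eq_intros)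
    moreover have "\<forall>\<^sub>F h in at_right 0. h ^ (4 - n) = (h::real) ^ 4 / h ^ n"
      using assms(2) eventually_at_right_less[of 0] by (auto elim!: eventually_mono simp: power_diff)
    ultimately show "((\<lambda>h::real. h ^ 4 / h ^ n) \<longlongrightarrow> 0) (at_right 0)"
      by (rule Lim_transform_eventually)
    show "\<forall>\<^sub>F h::real in at_right 0. h ^ n \<noteq> 0"
      using eventually_at_right_less by (rule eventually_mono) simp
  qed
  with 1 have "(\<lambda>h. R (h *\<^sub>R z)) \<in> o[at_right 0](\<lambda>h. h ^ n)"
    by (rule landau_o.big_small_trans)
  then show ?case using smalloD_tendsto by fastforce
next
  case (Cons d w)
  show ?case
    using tendsto_diff[OF Cons.IH[of "z + axis_vector d"] Cons.IH[of z]]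
    by (simp add: algebra_simps diff_divide_distrib)
qed

lemma iterated_difference_add:
  "iterated_difference w h (\<lambda>p. g p + k p) p = iterated_difference w h g p + iterated_difference w h k p"
  by (induction w arbitrary: p) (auto simp: algebra_simps)

text \<open>
  Here \<open>P\<close> is meant to be a polynomial, for which the difference quotient \<open>Q h\<close> is an explicit
  polynomial in \<open>h\<close>; its value at \<open>0\<close> is the derivative.
\<close>

lemma iterated_partial_eq_difference_limit:
  assumes "open U" "0 \<in> U" "C_k_on (length w) U f"
    and "(\<lambda>p. f p - P p) \<in> O[nhds 0](\<lambda>p. norm p ^ 4)" "length w \<le> 3"
    and "\<And>h. iterated_difference w h P 0 = h ^ length w * Q h"
    and "isCont Q 0"
  shows "iterated_partial w f 0 = Q 0"
proof -
  let ?n = "length w"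
  have split: "iterated_difference w h f 0 =
      iterated_difference w h P 0 + iterated_difference w h (\<lambda>p. f p - P p) 0" for h
    using iterated_difference_add[of w h P "\<lambda>p. f p - P p" 0] by simp
  have "((\<lambda>h. iterated_difference w h P 0 / h ^ ?n) \<longlongrightarrow> Q 0) (at_right 0)"
  proof (rule Lim_transform_eventually)
    show "(Q \<longlongrightarrow> Q 0) (at_right 0)"
      using assms(7) by (meson filterlim_at_split isCont_def)
    show "\<forall>\<^sub>F h in at_right 0. Q h = iterated_difference w h P 0 / h ^ ?n"
      using eventually_at_right_less by (rule eventually_mono) (simp add: assms(6))
  qed
  moreover have "((\<lambda>h. iterated_difference w h (\<lambda>p. f p - P p) 0 / h ^ ?n) \<longlongrightarrow> 0) (at_right 0)"
    using iterated_difference_small[OF assms(4,5), of w 0] by simp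
  ultimately have "((\<lambda>h. iterated_difference w h f 0 / h ^ ?n) \<longlongrightarrow> Q 0) (at_right 0)"
    using tendsto_add by (fastforce simp: split add_divide_distrib)
  with iterated_difference_quotient_tendsto[OF assms(1-3)] show ?thesis
    using tendsto_unique trivial_limit_at_right_real by blast
qed

lemma jet_from_remainder:
  fixes f :: "real \<times> real \<Rightarrow> real"
  assumes "open U" "0 \<in> U" "smooth_function_on U f"
    and R: "(\<lambda>p. f p - (case p of (x, y) \<Rightarrow>
        x^2 - c * y^2 + b0 * x^3 + b1 * x^2 * y + b2 * x * y^2 + b3 * y^3))
       \<in> O[nhds 0](\<lambda>p. norm p ^ 4)"
  shows "Dx f 0 = 0" "Dy f 0 = 0"
    "Dx (Dx f) 0 = 2" "Dy (Dx f) 0 = 0" "Dx (Dy f) 0 = 0" "Dy (Dy f) 0 = - 2 * c"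
    "Dx (Dx (Dx f)) 0 = 6 * b0" "Dy (Dx (Dx f)) 0 = 2 * b1"
    "Dy (Dy (Dx f)) 0 = 2 * b2" "Dy (Dy (Dy f)) 0 = 6 * b3"
proof -
  have C: "C_k_on k U f" for k using assms(3) by (simp add: smooth_function_on_def)
  note * = iterated_partial_eq_difference_limit[OF assms(1,2) C R]
  note expand = power2_eq_square power3_eq_cube algebra_simps zero_prod_def
  \<comment> \<open>The functions of \<open>h\<close> are the difference quotients of the cubic polynomial at the origin.\<close>
  show "Dx f 0 = 0"
    using *[of "[X_axis]" "\<lambda>h. h + b0 * h^2"] by (simp add: expand)
  show "Dy f 0 = 0"
    using *[of "[Y_axis]" "\<lambda>h. - c * h + b3 * h^2"] by (simp add: expand)
  show "Dx (Dx f) 0 = 2"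
    using *[of "[X_axis, X_axis]" "\<lambda>h. 2 + 6 * b0 * h"] by (simp add: expand)
  show "Dy (Dx f) 0 = 0"
    using *[of "[X_axis, Y_axis]" "\<lambda>h. (b1 + b2) * h"] by (simp add: expand)
  show "Dx (Dy f) 0 = 0"
    using *[of "[Y_axis, X_axis]" "\<lambda>h. (b1 + b2) * h"] by (simp add: expand)
  show "Dy (Dy f) 0 = - 2 * c"
    using *[of "[Y_axis, Y_axis]" "\<lambda>h. - 2 * c + 6 * b3 * h"] by (simp add: expand)
  show "Dx (Dx (Dx f)) 0 = 6 * b0"
    using *[of "[X_axis, X_axis, X_axis]" "\<lambda>h. 6 * b0"] by (simp add: expand)
  show "Dy (Dx (Dx f)) 0 = 2 * b1"
    using *[of "[X_axis, X_axis, Y_axis]" "\<lambda>h. 2 * b1"] by (simp add: expand)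
  show "Dy (Dy (Dx f)) 0 = 2 * b2"
    using *[of "[X_axis, Y_axis, Y_axis]" "\<lambda>h. 2 * b2"] by (simp add: expand)
  show "Dy (Dy (Dy f)) 0 = 6 * b3"
    using *[of "[Y_axis, Y_axis, Y_axis]" "\<lambda>h. 6 * b3"] by (simp add: expand)
qed

section \<open>Tangent directions of a branch\<close>

lemma tendsto_scaleR_divided:
  fixes u :: "'a \<Rightarrow> 'b::real_normed_vector"
  assumes "((\<lambda>x. u x /\<^sub>R \<tau> x) \<longlongrightarrow> v) F" "filterlim \<tau> (at 0) F"
  shows "(u \<longlongrightarrow> 0) F"
proof (rule Lim_transform_eventually)
  have "(\<tau> \<longlongrightarrow> 0) F" "\<forall>\<^sub>F x in F. \<tau> x \<noteq> 0"
    using assms(2) by (auto simp: filterlim_at)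
  show "((\<lambda>x. \<tau> x *\<^sub>R (u x /\<^sub>R \<tau> x)) \<longlongrightarrow> 0) F"
    using tendsto_scaleR[OF \<open>(\<tau> \<longlongrightarrow> 0) F\<close> assms(1)] by simp
  show "\<forall>\<^sub>F x in F. \<tau> x *\<^sub>R (u x /\<^sub>R \<tau> x) = u x"
    using \<open>\<forall>\<^sub>F x in F. \<tau> x \<noteq> 0\<close> by (rule eventually_mono) simp
qed

text \<open>
  The first-order behaviour of \<open>g\<close> along any family of points that approach the origin with a
  limiting rescaled position. It is used for the gradient of \<open>f\<close> along a branch, and for the branch
  itself with \<open>u\<close> the identity.
\<close>

lemma derivative_along_direction:
  fixes g :: "'a::real_normed_vector \<Rightarrow> 'b::real_normed_vector"
  assumes g: "(g has_derivative L) (at 0)" "g 0 = 0"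
    and u: "((\<lambda>x. u x /\<^sub>R \<tau> x) \<longlongrightarrow> v) F" and \<tau>: "filterlim \<tau> (at 0) F"
  shows "((\<lambda>x. g (u x) /\<^sub>R \<tau> x) \<longlongrightarrow> L v) F"
proof -
  interpret L: bounded_linear L using g(1) by (rule has_derivative_bounded_linear)
  \<comment> \<open>The remainder divided by \<open>norm y\<close> takes the value \<open>0\<close> at \<open>0\<close>, so it is continuous there.\<close>
  define e where "e y = (g y - L y) /\<^sub>R norm y" for y
  have "(e \<longlongrightarrow> 0) (at 0)"
    using g by (intro tendsto_norm_zero_cancel[of e]) (simp add: has_derivative_at e_def divide_inverse mult.commute)
  then have "isCont e 0" by (simp add: isCont_def e_def)
  then have e: "((\<lambda>x. e (u x)) \<longlongrightarrow> 0) F"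
    using isCont_tendsto_compose[OF _ tendsto_scaleR_divided[OF u \<tau>], of e] by (simp add: e_def)
  have "((\<lambda>x. norm (u x) / \<bar>\<tau> x\<bar>) \<longlongrightarrow> norm v) F"
    using tendsto_norm[OF u] by (simp add: divide_inverse mult.commute)
  from tendsto_mult[OF this tendsto_norm[OF e]]
  have "((\<lambda>x. (norm (u x) / \<tau> x) *\<^sub>R e (u x)) \<longlongrightarrow> 0) F"
    by - (rule tendsto_norm_zero_cancel, simp)
  from tendsto_add[OF L.tendsto[OF u] this]
  have "((\<lambda>x. L (u x /\<^sub>R \<tau> x) + (norm (u x) / \<tau> x) *\<^sub>R e (u x)) \<longlongrightarrow> L v) F" by simp
  moreover have "L (u x /\<^sub>R \<tau> x) + (norm (u x) / \<tau> x) *\<^sub>R e (u x) = g (u x) /\<^sub>R \<tau> x" for x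
  proof (cases "u x = 0")
    case True
    then show ?thesis by (simp add: L.zero g(2))
  next
    case False
    then have "(norm (u x) / \<tau> x) *\<^sub>R e (u x) = (g (u x) - L (u x)) /\<^sub>R \<tau> x"
      by (simp add: e_def divide_inverse)
    then show ?thesis by (simp add: L.scaleR scaleR_diff_right)
  qed
  ultimately show ?thesis by simp
qed

text \<open>
  Since \<open>\<tau>\<close> is continuous on \<open>B\<close>, points of \<open>B\<close> that tend to the origin have parameters that tend to
  \<open>0\<close>, so the limits along \<open>B\<close> become limits in the parameter.
\<close>

lemma smooth_branch_parameter:
  assumes "smooth_branch Z L B"
  obtains \<tau> v where "span {v} = L" "v \<noteq> 0"
    "((\<lambda>q. q /\<^sub>R \<tau> q) \<longlongrightarrow> v) (at 0 within B)" "filterlim \<tau> (at 0) (at 0 within B)"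
proof -
  obtain e \<gamma> \<tau> where e: "e > 0" and smooth: "smooth_curve_on {-e<..<e} \<gamma>"
    and hom: "homeomorphism {-e<..<e} B \<gamma> \<tau>"
    and reg: "\<forall>t\<in>{-e<..<e}. vector_derivative \<gamma> (at t) \<noteq> 0"
    and \<gamma>0: "\<gamma> 0 = 0" and L: "span {vector_derivative \<gamma> (at 0)} = L"
    using assms unfolding smooth_branch_def zero_prod_def by auto
  define v where "v = vector_derivative \<gamma> (at 0)"
  have "\<gamma> differentiable_on {-e<..<e}"
    using smooth unfolding smooth_curve_on_def by (auto dest: spec[of _ 0])
  then have "\<gamma> differentiable (at 0)"
    using e by (simp add: differentiable_on_eq_differentiable_at)
  then have "(\<gamma> has_vector_derivative v) (at 0)"
    unfolding v_def by (simp add: vector_derivative_works)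
  then have quot: "((\<lambda>t. \<gamma> t /\<^sub>R t) \<longlongrightarrow> v) (at 0)"
  proof -
    have "((\<lambda>t::real. t /\<^sub>R t) \<longlongrightarrow> 1) (at 0)"
      by (rule Lim_transform_eventually[of "\<lambda>_. 1"]) (auto simp: eventually_at_filter)
    moreover have "(\<gamma> has_derivative (\<lambda>t. t *\<^sub>R v)) (at 0)"
      using \<open>(\<gamma> has_vector_derivative v) (at 0)\<close> by (simp add: has_vector_derivative_def)
    ultimately show ?thesis
      using derivative_along_direction
          [where g = \<gamma> and u = "\<lambda>t. t" and \<tau> = "\<lambda>t. t" and F = "at 0" and v = 1]
        \<gamma>0 filterlim_ident by fastforce
  qed
  have \<tau>\<gamma>: "\<gamma> (\<tau> q) = q" if "q \<in> B" for q
    using hom that by (simp add: homeomorphism_def)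
  have "\<tau> (\<gamma> 0) = 0" "\<gamma> 0 \<in> B"
    using hom e unfolding homeomorphism_def by auto
  then have \<tau>0: "\<tau> 0 = 0" and "0 \<in> B" by (simp_all add: \<gamma>0)
  have "(\<tau> \<longlongrightarrow> 0) (at 0 within B)"
    using homeomorphism_cont2[OF hom] \<open>0 \<in> B\<close> \<tau>0 by (auto simp: continuous_on_def)
  moreover have "\<forall>\<^sub>F q in at 0 within B. \<tau> q \<noteq> 0"
    unfolding eventually_at_filter using \<tau>\<gamma> \<gamma>0 by (intro always_eventually) metis
  ultimately have lim: "filterlim \<tau> (at 0) (at 0 within B)"
    by (simp add: filterlim_at)
  have "((\<lambda>q. \<gamma> (\<tau> q) /\<^sub>R \<tau> q) \<longlongrightarrow> v) (at 0 within B)"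
    by (rule filterlim_compose[OF quot lim])
  then have "((\<lambda>q. q /\<^sub>R \<tau> q) \<longlongrightarrow> v) (at 0 within B)"
    by (rule Lim_transform_eventually) (auto simp: eventually_at_filter \<tau>\<gamma>)
  moreover have "v \<noteq> 0" using reg e by (simp add: v_def)
  ultimately show thesis using that L lim v_def by blast
qed


section \<open>Curvature at the vertices of a level curve\<close>

text \<open>
  In terms of \<open>w = (- f\<^sub>y, f\<^sub>x)\<close>, the next two functions are \<open>D\<^sup>2f(w, w)\<close> and \<open>D\<^sup>3f(w, w, w)\<close>.
\<close>

definition tangential_second :: "(real \<times> real \<Rightarrow> real) \<Rightarrow> real \<times> real \<Rightarrow> real" where
  "tangential_second f p =
    Dx (Dx f) p * (Dy f p)^2 - 2 * Dy (Dx f) p * Dx f p * Dy f p + Dy (Dy f) p * (Dx f p)^2"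

definition tangential_third :: "(real \<times> real \<Rightarrow> real) \<Rightarrow> real \<times> real \<Rightarrow> real" where
  "tangential_third f p =
    - (Dy f p ^ 3 * Dx (Dx (Dx f)) p) + 3 * Dx f p * (Dy f p)^2 * Dy (Dx (Dx f)) p
    - 3 * (Dx f p)^2 * Dy f p * Dy (Dy (Dx f)) p + Dx f p ^ 3 * Dy (Dy (Dy f)) p"

text \<open>Half of the derivative of \<open>|\<nabla>f|\<^sup>2\<close> in the direction \<open>(- f\<^sub>y, f\<^sub>x)\<close>.\<close>

definition gradient_growth :: "(real \<times> real \<Rightarrow> real) \<Rightarrow> real \<times> real \<Rightarrow> real" where
  "gradient_growth f p =
    Dx f p * Dy f p * (Dy (Dy f) p - Dx (Dx f) p) + Dy (Dx f) p * ((Dx f p)^2 - (Dy f p)^2)"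

definition gradient_square :: "(real \<times> real \<Rightarrow> real) \<Rightarrow> real \<times> real \<Rightarrow> real" where
  "gradient_square f p = (Dx f p)^2 + (Dy f p)^2"

text \<open>
  For smooth \<open>f\<close>, the right-hand side is the derivative of \<open>tangential_second f / |\<nabla>f|\<^sup>3\<close> along \<open>(- f\<^sub>y, f\<^sub>x)\<close>, multiplied
  by \<open>|\<nabla>f|\<^sup>5\<close>.
\<close>

lemma vertex_function_eq:
  "vertex_function f p =
     gradient_square f p * tangential_third f p - 3 * tangential_second f p * gradient_growth f p"
  unfolding vertex_function_def Let_def gradient_square_def tangential_third_def
    tangential_second_def gradient_growth_def
  by algebra

lemma level_curvature_eq:
  "level_curvature f p = tangential_second f p / sqrt (gradient_square f p) ^ 3"
  by (simp add: level_curvature_def tangential_second_def gradient_square_def Let_def)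

text \<open>
  Solving \<open>vertex_function f p = 0\<close> for \<open>tangential_second f p\<close>, whose leading term vanishes along the
  branches tangent to \<open>x = \<plusminus> a y\<close>. There the leading terms of the functions on the right-hand side
  determine the limit.
\<close>

lemma level_curvature_at_vertex:
  assumes "vertex_function f p = 0" "gradient_growth f p \<noteq> 0"
  shows "level_curvature f p =
    tangential_third f p / (3 * gradient_growth f p * sqrt (gradient_square f p))"
proof (cases "gradient_square f p = 0")
  case True
  then show ?thesis by (simp add: level_curvature_eq)
next
  case False
  define s where "s = sqrt (gradient_square f p)"
  have "gradient_square f p \<ge> 0" by (simp add: gradient_square_def)
  with False have s: "s > 0" "gradient_square f p = s\<^sup>2" by (auto simp: s_def)
  have "s\<^sup>2 * tangential_third f p = 3 * tangential_second f p * gradient_growth f p"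
    using assms(1) by (simp add: vertex_function_eq s)
  then have "tangential_second f p = s\<^sup>2 * tangential_third f p / (3 * gradient_growth f p)"
    using assms(2) by (simp add: eq_divide_eq mult.assoc mult.left_commute)
  then show ?thesis
    using s(1) by (simp add: level_curvature_eq s_def[symmetric] power2_eq_square power3_eq_cube)
qed

section \<open>Limits along a branch at a saddle point\<close>

locale saddle_jet =
  fixes f :: "real \<times> real \<Rightarrow> real" and U :: "(real \<times> real) set" and a b0 b1 b2 b3 :: real
  assumes open_domain: "open U" and origin_in_domain: "0 \<in> U"
    and smooth: "smooth_function_on U f" and a_pos: "a > 0"
    and remainder: "(\<lambda>p. f p - (case p of (x, y) \<Rightarrow>
        x^2 - a^2 * y^2 + b0 * x^3 + b1 * x^2 * y + b2 * x * y^2 + b3 * y^3))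
       \<in> O[nhds 0](\<lambda>p. norm p ^ 4)"
begin

lemmas jet = jet_from_remainder[OF open_domain origin_in_domain smooth remainder]

lemma C_k: "C_k_on k U f"
  using smooth by (simp add: smooth_function_on_def)

lemma iterated_partial_tendsto:
  assumes "(u \<longlongrightarrow> 0) F"
  shows "((\<lambda>x. iterated_partial w f (u x)) \<longlongrightarrow> iterated_partial w f 0) F"
proof -
  have "continuous_on U (iterated_partial w f)"
    using C_k_on_iterated_partial[of w 0, OF C_k] by simp
  then have "isCont (iterated_partial w f) 0"
    using open_domain origin_in_domain by (simp add: continuous_on_eq_continuous_at)
  then show ?thesis using assms by (rule isCont_tendsto_compose)
qed

lemma gradient_has_derivative:
  "(Dx f has_derivative (\<lambda>z. 2 * fst z)) (at 0)"
  "(Dy f has_derivative (\<lambda>z. - 2 * a^2 * snd z)) (at 0)"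
proof -
  have *: "(g has_derivative (\<lambda>z. fst z * Dx g 0 + snd z * Dy g 0)) (at 0)"
    if "g differentiable_on U" for g :: "real \<times> real \<Rightarrow> real"
  proof -
    have "g differentiable (at 0)"
      using that origin_in_domain differentiable_on_eq_differentiable_at[OF open_domain] by blast
    then obtain L where L: "(g has_derivative L) (at 0)"
      unfolding differentiable_def by blast
    moreover have "L = (\<lambda>z. fst z * Dx g 0 + snd z * Dy g 0)"
      by (rule ext) (metis has_derivative_partials[OF L] prod.collapse)
    ultimately show ?thesis by simp
  qed
  have "Dx f differentiable_on U" "Dy f differentiable_on U"
    using C_k[of "Suc (Suc 0)"] by auto
  from this[THEN *] show "(Dx f has_derivative (\<lambda>z. 2 * fst z)) (at 0)"
    "(Dy f has_derivative (\<lambda>z. - 2 * a^2 * snd z)) (at 0)"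
    by (simp_all add: jet mult.commute[of "fst _"] mult.commute[of "snd _"])
qed

text \<open>
  In this context \<open>F\<close> describes the approach to the origin along a branch with tangent vector \<open>v\<close>.
  Every quantity is divided by the power of \<open>\<tau>\<close> equal to its degree in the gradient.
\<close>

context
  fixes F :: "(real \<times> real) filter" and \<tau> :: "real \<times> real \<Rightarrow> real" and v :: "real \<times> real"
  assumes direction: "((\<lambda>q. q /\<^sub>R \<tau> q) \<longlongrightarrow> v) F" and scale: "filterlim \<tau> (at 0) F"
begin

lemma gradient_tendsto:
  "((\<lambda>q. Dx f q / \<tau> q) \<longlongrightarrow> 2 * fst v) F"
  "((\<lambda>q. Dy f q / \<tau> q) \<longlongrightarrow> - 2 * a^2 * snd v) F"
  using derivative_along_direction[OF gradient_has_derivative(1) jet(1) direction scale]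
    derivative_along_direction[OF gradient_has_derivative(2) jet(2) direction scale]
  by (simp_all add: divide_inverse mult.commute)

lemma higher_partials_tendsto:
  "(Dx (Dx f) \<longlongrightarrow> 2) F" "(Dy (Dx f) \<longlongrightarrow> 0) F" "(Dy (Dy f) \<longlongrightarrow> - 2 * a^2) F"
  "(Dx (Dx (Dx f)) \<longlongrightarrow> 6 * b0) F" "(Dy (Dx (Dx f)) \<longlongrightarrow> 2 * b1) F"
  "(Dy (Dy (Dx f)) \<longlongrightarrow> 2 * b2) F" "(Dy (Dy (Dy f)) \<longlongrightarrow> 6 * b3) F"
proof -
  note * = iterated_partial_tendsto[OF tendsto_scaleR_divided[OF direction scale]]
  show "(Dx (Dx f) \<longlongrightarrow> 2) F" using *[of "[X_axis, X_axis]"] by (simp add: jet)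
  show "(Dy (Dx f) \<longlongrightarrow> 0) F" using *[of "[X_axis, Y_axis]"] by (simp add: jet)
  show "(Dy (Dy f) \<longlongrightarrow> - 2 * a^2) F" using *[of "[Y_axis, Y_axis]"] by (simp add: jet)
  show "(Dx (Dx (Dx f)) \<longlongrightarrow> 6 * b0) F"
    using *[of "[X_axis, X_axis, X_axis]"] by (simp add: jet)
  show "(Dy (Dx (Dx f)) \<longlongrightarrow> 2 * b1) F"
    using *[of "[X_axis, X_axis, Y_axis]"] by (simp add: jet)
  show "(Dy (Dy (Dx f)) \<longlongrightarrow> 2 * b2) F"
    using *[of "[X_axis, Y_axis, Y_axis]"] by (simp add: jet)
  show "(Dy (Dy (Dy f)) \<longlongrightarrow> 6 * b3) F"
    using *[of "[Y_axis, Y_axis, Y_axis]"] by (simp add: jet)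
qed

lemmas scaled_tendsto_intros =
  tendsto_add tendsto_diff tendsto_minus tendsto_mult tendsto_power tendsto_const
  gradient_tendsto higher_partials_tendsto

lemma gradient_square_tendsto:
  "((\<lambda>q. gradient_square f q / \<tau> q ^ 2) \<longlongrightarrow> (2 * fst v)^2 + (- 2 * a^2 * snd v)^2) F"
proof -
  have "((\<lambda>q. (Dx f q / \<tau> q)^2 + (Dy f q / \<tau> q)^2) \<longlongrightarrow>
      (2 * fst v)^2 + (- 2 * a^2 * snd v)^2) F"
    by (intro scaled_tendsto_intros)
  then show ?thesis by (simp add: gradient_square_def add_divide_distrib power_divide)
qed

lemma tangential_second_tendsto:
  "((\<lambda>q. tangential_second f q / \<tau> q ^ 2) \<longlongrightarrow> 8 * a^2 * (a^2 * (snd v)^2 - (fst v)^2)) F"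
proof -
  have scaled: "tangential_second f q / \<tau> q ^ 2 =
      Dx (Dx f) q * (Dy f q / \<tau> q)^2 - 2 * Dy (Dx f) q * (Dx f q / \<tau> q) * (Dy f q / \<tau> q)
      + Dy (Dy f) q * (Dx f q / \<tau> q)^2" for q
    by (simp add: tangential_second_def add_divide_distrib diff_divide_distrib power2_eq_square)
  have limit: "8 * a^2 * (a^2 * (snd v)^2 - (fst v)^2) =
      2 * (- 2 * a^2 * snd v)^2 - 2 * 0 * (2 * fst v) * (- 2 * a^2 * snd v)
      + (- 2 * a^2) * (2 * fst v)^2"
    by (simp add: algebra_simps power2_eq_square)
  show ?thesis
    unfolding scaled limit by (intro scaled_tendsto_intros)
qed

lemma gradient_growth_tendsto:
  "((\<lambda>q. gradient_growth f q / \<tau> q ^ 2) \<longlongrightarrow> 8 * a^2 * (1 + a^2) * fst v * snd v) F"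
proof -
  have scaled: "gradient_growth f q / \<tau> q ^ 2 =
      (Dx f q / \<tau> q) * (Dy f q / \<tau> q) * (Dy (Dy f) q - Dx (Dx f) q)
      + Dy (Dx f) q * ((Dx f q / \<tau> q)^2 - (Dy f q / \<tau> q)^2)" for q
    by (simp add: gradient_growth_def add_divide_distrib diff_divide_distrib power2_eq_square
        right_diff_distrib)
  have limit: "8 * a^2 * (1 + a^2) * fst v * snd v =
      (2 * fst v) * (- 2 * a^2 * snd v) * (- 2 * a^2 - 2)
      + 0 * ((2 * fst v)^2 - (- 2 * a^2 * snd v)^2)"
    by (simp add: algebra_simps power2_eq_square)
  show ?thesis
    unfolding scaled limit by (intro scaled_tendsto_intros)
qed

lemma tangential_third_tendsto:
  "((\<lambda>q. tangential_third f q / \<tau> q ^ 3) \<longlongrightarrow>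
     48 * (a^6 * (snd v)^3 * b0 + a^4 * fst v * (snd v)^2 * b1
           + a^2 * (fst v)^2 * snd v * b2 + (fst v)^3 * b3)) F"
proof -
  have scaled: "tangential_third f q / \<tau> q ^ 3 =
      - ((Dy f q / \<tau> q) ^ 3 * Dx (Dx (Dx f)) q)
      + 3 * (Dx f q / \<tau> q) * (Dy f q / \<tau> q)^2 * Dy (Dx (Dx f)) q
      - 3 * (Dx f q / \<tau> q)^2 * (Dy f q / \<tau> q) * Dy (Dy (Dx f)) q
      + (Dx f q / \<tau> q) ^ 3 * Dy (Dy (Dy f)) q" for q
    by (simp add: tangential_third_def add_divide_distrib diff_divide_distrib power2_eq_square
        power3_eq_cube)
  have limit: "48 * (a^6 * (snd v)^3 * b0 + a^4 * fst v * (snd v)^2 * b1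
           + a^2 * (fst v)^2 * snd v * b2 + (fst v)^3 * b3) =
      - ((- 2 * a^2 * snd v) ^ 3 * (6 * b0))
      + 3 * (2 * fst v) * (- 2 * a^2 * snd v)^2 * (2 * b1)
      - 3 * (2 * fst v)^2 * (- 2 * a^2 * snd v) * (2 * b2)
      + (2 * fst v) ^ 3 * (6 * b3)"
    by algebra
  show ?thesis
    unfolding scaled limit by (intro scaled_tendsto_intros)
qed

lemma gradient_square_limit_pos:
  assumes "v \<noteq> 0"
  shows "(2 * fst v)^2 + (- 2 * a^2 * snd v)^2 > 0"
  unfolding sum_power2_gt_zero_iff using assms a_pos by (auto simp: prod_eq_iff)

lemma eventually_gradient_nonzero:
  assumes "v \<noteq> 0"
  shows "\<forall>\<^sub>F q in F. (Dx f q, Dy f q) \<noteq> (0, 0)"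
  using order_tendstoD(1)[OF gradient_square_tendsto gradient_square_limit_pos[OF assms]]
  by (rule eventually_mono) (auto simp: gradient_square_def)

text \<open>
  The condition on \<open>v\<close> excludes the two asymptotic directions of the Hessian. In every other
  direction the leading term of the curvature numerator survives, and the curvature grows like
  \<open>1 / |\<tau>|\<close>.
\<close>

lemma level_curvature_at_top:
  assumes "v \<noteq> 0" "a^2 * (snd v)^2 \<noteq> (fst v)^2"
  shows "filterlim (\<lambda>q. \<bar>level_curvature f q\<bar>) at_top F"
proof -
  let ?g = "(2 * fst v)^2 + (- 2 * a^2 * snd v)^2"
  have \<tau>: "(\<tau> \<longlongrightarrow> 0) F" "\<forall>\<^sub>F q in F. \<tau> q \<noteq> 0"
    using scale by (auto simp: filterlim_at)
  have "((\<lambda>q. \<bar>tangential_second f q / \<tau> q ^ 2\<bar> / sqrt (gradient_square f q / \<tau> q ^ 2) ^ 3)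
      \<longlongrightarrow> \<bar>8 * a^2 * (a^2 * (snd v)^2 - (fst v)^2)\<bar> / sqrt ?g ^ 3) F"
    using gradient_square_limit_pos[OF assms(1)]
    by (intro tendsto_divide tendsto_rabs tendsto_power tendsto_real_sqrt
        tangential_second_tendsto gradient_square_tendsto) auto
  moreover have "\<bar>8 * a^2 * (a^2 * (snd v)^2 - (fst v)^2)\<bar> / sqrt ?g ^ 3 > 0"
    using gradient_square_limit_pos[OF assms(1)] assms(2) a_pos by simp
  moreover have "filterlim (\<lambda>q. inverse \<bar>\<tau> q\<bar>) at_top F"
    using eventually_mono[OF \<tau>(2)] by (intro filterlim_inverse_at_top tendsto_rabs_zero \<tau>(1)) simp
  ultimately have "filterlim (\<lambda>q. \<bar>tangential_second f q / \<tau> q ^ 2\<bar>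
      / sqrt (gradient_square f q / \<tau> q ^ 2) ^ 3 * inverse \<bar>\<tau> q\<bar>) at_top F"
    by (rule filterlim_tendsto_pos_mult_at_top)
  moreover have "\<forall>\<^sub>F q in F. \<bar>tangential_second f q / \<tau> q ^ 2\<bar>
      / sqrt (gradient_square f q / \<tau> q ^ 2) ^ 3 * inverse \<bar>\<tau> q\<bar> = \<bar>level_curvature f q\<bar>"
    using \<tau>(2)
  proof eventually_elim
    case (elim q)
    have "\<tau> q ^ 2 = \<bar>\<tau> q\<bar>^2" by simp
    then show ?case using elim
      by (simp add: level_curvature_eq real_sqrt_divide power_divide gradient_square_def
          power2_eq_square power3_eq_cube abs_mult del: abs_mult_self_eq)
  qed
  ultimately show ?thesis
    by (rule filterlim_cong[OF refl refl, THEN iffD1, rotated])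
qed

text \<open>
  With \<open>m = \<plusminus> a\<close> both asymptotic directions are treated at once: the leading coefficient of
  \<open>tangential_third\<close> is then a multiple of \<open>b0 * m^3 + b1 * m^2 + b2 * m + b3\<close>.
\<close>

lemma level_curvature_at_vertices_tendsto:
  assumes "v \<noteq> 0" "fst v = m * snd v" "m^2 = a^2" "\<forall>\<^sub>F q in F. vertex_function f q = 0"
  shows "((\<lambda>q. \<bar>level_curvature f q\<bar>) \<longlongrightarrow>
    \<bar>b0 * m^3 + b1 * m^2 + b2 * m + b3\<bar> / (a * (1 + a^2) powr (3/2))) F"
proof -
  let ?G = "(2 * fst v)^2 + (- 2 * a^2 * snd v)^2"
  let ?S = "8 * a^2 * (1 + a^2) * fst v * snd v"
  let ?T = "48 * (a^6 * (snd v)^3 * b0 + a^4 * fst v * (snd v)^2 * b1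
           + a^2 * (fst v)^2 * snd v * b2 + (fst v)^3 * b3)"
  define c r where "c = snd v" and "r = sqrt (1 + a^2)"
  have m: "\<bar>m\<bar> = a" using assms(3) a_pos by (metis abs_of_pos real_sqrt_abs)
  have v: "snd v = c" "fst v = m * c" and c: "c \<noteq> 0" and "m \<noteq> 0"
    using assms(1,2) m a_pos by (auto simp: c_def prod_eq_iff)
  have r: "r > 0" "r^2 = 1 + a^2" by (auto simp: r_def add_pos_nonneg)
  have G: "sqrt ?G = 2 * a * \<bar>c\<bar> * r"
  proof (rule real_sqrt_unique)
    have "(2 * a * \<bar>c\<bar> * r)^2 = 4 * a^2 * c^2 * r^2" by (simp add: power_mult_distrib)
    then show "(2 * a * \<bar>c\<bar> * r)^2 = ?G"
      unfolding v r(2) using assms(3) by algebra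
  qed (use r a_pos in auto)
  have T: "\<bar>?T\<bar> = 48 * a^3 * \<bar>c\<bar>^3 * \<bar>b0 * m^3 + b1 * m^2 + b2 * m + b3\<bar>"
  proof -
    have "?T = 48 * m^3 * c^3 * (b0 * m^3 + b1 * m^2 + b2 * m + b3)"
    proof -
      have "a^4 = m^4" "a^6 = m^6"
        using assms(3) by algebra+
      then show ?thesis unfolding v using assms(3) by algebra
    qed
    then show ?thesis by (simp add: abs_mult power_abs m)
  qed
  have S: "\<bar>?S\<bar> = 8 * a^3 * c^2 * r^2"
    unfolding v r(2) using m a_pos by (simp add: abs_mult power2_eq_square power3_eq_cube)
  have "1 + a^2 > 0" by (simp add: add_pos_nonneg)
  then have powr: "(1 + a^2) powr (3/2) = r^3"
    by (simp add: r_def powr_half_sqrt[symmetric] powr_powr flip: powr_realpow)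
  have "((\<lambda>q. \<bar>tangential_third f q / \<tau> q ^ 3\<bar>
      / (3 * \<bar>gradient_growth f q / \<tau> q ^ 2\<bar> * sqrt (gradient_square f q / \<tau> q ^ 2)))
      \<longlongrightarrow> \<bar>?T\<bar> / (3 * \<bar>?S\<bar> * sqrt ?G)) F"
    using gradient_square_limit_pos[OF assms(1)] a_pos r c
    by (intro tendsto_divide tendsto_mult tendsto_rabs tendsto_power tendsto_real_sqrt tendsto_const
        tangential_third_tendsto gradient_square_tendsto gradient_growth_tendsto) (auto simp: G S)
  moreover have "\<bar>?T\<bar> / (3 * \<bar>?S\<bar> * sqrt ?G) =
      \<bar>b0 * m^3 + b1 * m^2 + b2 * m + b3\<bar> / (a * (1 + a^2) powr (3/2))"
    unfolding T S G powr using a_pos r(1) c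
    by (simp add: field_simps power2_eq_square power3_eq_cube)
  moreover have "\<forall>\<^sub>F q in F. \<bar>tangential_third f q / \<tau> q ^ 3\<bar>
      / (3 * \<bar>gradient_growth f q / \<tau> q ^ 2\<bar> * sqrt (gradient_square f q / \<tau> q ^ 2)) =
      \<bar>level_curvature f q\<bar>"
  proof -
    have "?S \<noteq> 0" using S a_pos c r by (metis abs_zero mult_eq_0_iff power_not_zero less_irrefl zero_neq_numeral)
    then have "\<forall>\<^sub>F q in F. gradient_growth f q / \<tau> q ^ 2 \<noteq> 0"
      by (rule tendsto_imp_eventually_ne[OF gradient_growth_tendsto])
    moreover have "\<forall>\<^sub>F q in F. \<tau> q \<noteq> 0"
      using scale by (auto simp: filterlim_at)
    ultimately show ?thesis using assms(4)
    proof eventually_elim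
      case (elim q)
      then have "gradient_growth f q \<noteq> 0" by auto
      then show ?case using elim
        by (simp add: level_curvature_at_vertex real_sqrt_divide gradient_square_def
          power2_eq_square power3_eq_cube abs_mult del: abs_mult_self_eq)
    qed
  qed
  ultimately show ?thesis
    using Lim_transform_eventually by fastforce
qed

end

lemma branch_curvature_at_top:
  assumes "smooth_branch Z L B" "\<And>v. v \<in> L \<Longrightarrow> v \<noteq> 0 \<Longrightarrow> a^2 * (snd v)^2 \<noteq> (fst v)^2"
  shows "limiting_abs_curvature f B at_top"
proof -
  obtain \<tau> v where v: "span {v} = L" "v \<noteq> 0"
    and lim: "((\<lambda>q. q /\<^sub>R \<tau> q) \<longlongrightarrow> v) (at 0 within B)" "filterlim \<tau> (at 0) (at 0 within B)"
    using smooth_branch_parameter[OF assms(1)] .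
  have "v \<in> L" using v(1) span_base by blast
  then show ?thesis
    unfolding limiting_abs_curvature_def
    using eventually_gradient_nonzero[OF lim v(2)]
      level_curvature_at_top[OF lim v(2) assms(2)[OF _ v(2)]]
    by (simp add: zero_prod_def)
qed

lemma asymptotic_branch_curvature_tendsto:
  assumes branch: "smooth_branch (vertex_set U f) {(x, y). x = m * y} B" and "m^2 = a^2"
  shows "limiting_abs_curvature f B
    (nhds (\<bar>b0 * m^3 + b1 * m^2 + b2 * m + b3\<bar> / (a * (1 + a^2) powr (3/2))))"
proof -
  obtain \<tau> v where v: "span {v} = {(x, y). x = m * y}" "v \<noteq> 0"
    and lim: "((\<lambda>q. q /\<^sub>R \<tau> q) \<longlongrightarrow> v) (at 0 within B)" "filterlim \<tau> (at 0) (at 0 within B)"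
    using smooth_branch_parameter[OF branch] .
  have "v \<in> {(x, y). x = m * y}" using v(1) span_base by blast
  then have "fst v = m * snd v" by auto
  moreover have "\<forall>\<^sub>F q in at 0 within B. vertex_function f q = 0"
    using branch by (auto simp: smooth_branch_def vertex_set_def eventually_at_filter
        intro!: always_eventually)
  ultimately show ?thesis
    unfolding limiting_abs_curvature_def
    using eventually_gradient_nonzero[OF lim v(2)]
      level_curvature_at_vertices_tendsto[OF lim v(2) _ assms(2)]
    by (simp add: zero_prod_def)
qed

end

theorem proposition3p8:
  fixes f :: "real \<times> real \<Rightarrow> real" and U :: "(real \<times> real) set"
    and a b0 b1 b2 b3 :: real and f3 :: "real \<Rightarrow> real"
    and VH1 VH2 VH3 VH4 :: "(real \<times> real) set"
  assumes "open U" and "(0, 0) \<in> U" and "smooth_function_on U f"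
    and "a > 0"
    and "(\<lambda>(x, y). f (x, y) - (x^2 - a^2 * y^2 + b0 * x^3 + b1 * x^2 * y + b2 * x * y^2 + b3 * y^3))
           \<in> O[nhds (0, 0)](\<lambda>p. norm p ^ 4)"
    and "\<And>s. f3 s = b0 * s^3 + b1 * s^2 + b2 * s + b3"
    and "smooth_branch (vertex_set U f) {(x, y). x = 0} VH1"
    and "smooth_branch (vertex_set U f) {(x, y). y = 0} VH2"
    and "smooth_branch (vertex_set U f) {(x, y). x = a * y} VH3"
    and "smooth_branch (vertex_set U f) {(x, y). x = - a * y} VH4"
  shows "limiting_abs_curvature f VH1 at_top \<and>
         limiting_abs_curvature f VH2 at_top \<and>
         limiting_abs_curvature f VH3 (nhds \<bar>f3 a / (a * (1 + a^2) powr (3/2))\<bar>) \<and>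
         limiting_abs_curvature f VH4 (nhds \<bar>- (f3 (- a) / (a * (1 + a^2) powr (3/2)))\<bar>)"
proof -
  interpret saddle_jet f U a b0 b1 b2 b3
    using assms(1-5) by unfold_locales (simp_all add: zero_prod_def case_prod_unfold)
  have limit: "\<bar>f3 m / (a * (1 + a^2) powr (3/2))\<bar> =
      \<bar>b0 * m^3 + b1 * m^2 + b2 * m + b3\<bar> / (a * (1 + a^2) powr (3/2))" for m
    unfolding assms(6) using \<open>a > 0\<close> by (simp add: abs_divide abs_mult)
  show ?thesis
  proof (intro conjI)
    show "limiting_abs_curvature f VH1 at_top"
      using \<open>a > 0\<close> by (intro branch_curvature_at_top[OF assms(7)]) (auto simp: zero_prod_def)
    show "limiting_abs_curvature f VH2 at_top"
      using \<open>a > 0\<close> by (intro branch_curvature_at_top[OF assms(8)]) (auto simp: zero_prod_def)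
    show "limiting_abs_curvature f VH3 (nhds \<bar>f3 a / (a * (1 + a^2) powr (3/2))\<bar>)"
      unfolding limit by (rule asymptotic_branch_curvature_tendsto[OF assms(9)]) simp
    show "limiting_abs_curvature f VH4 (nhds \<bar>- (f3 (- a) / (a * (1 + a^2) powr (3/2)))\<bar>)"
      unfolding abs_minus_cancel limit
      by (rule asymptotic_branch_curvature_tendsto[OF assms(10)]) simp
  qed
qed

end
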